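(* Fix any $\varepsilon\in(0,1/3]$. Given distinct strings $\mathbf{x},\mathbf{y}\in\{0,1\}^n$ such that any mean-based algorithm requires $\exp(\Omega(n^{\varepsilon}))$ traces to distinguish between $\mathbf{x}$ and $\mathbf{y}$, the following two sets constitute a solution to the degree-$k$ Prouhet–Tarry–Escott (PTE) system: $$D(\mathbf{x})=\{i: x_i=1\},\qquad D(\mathbf{y})=\{i: y_i=1\},$$ with size $n=(k\log^2 k)^{1/\varepsilon}$.
   Context: PTE system: given an integer $k\ge0$, sets of integers $A=\{\alpha_1,\dots,\alpha_s\}$ and $B=\{\beta_1,\dots,\beta_s\}$ form a solution of size $s$ to the degree-$k$ PTE system if $\sum_{i=1}^s\alpha_i^j=\sum_{i=1}^s\beta_i^j$ for all $j\in\{1,\dots,k\}$, with $\alpha_i\ne\beta_j$ for all $i,j\in\{1,\dots,s\}$. Strings are indexed from $0$: $\mathbf{x}=x_0x_1\cdots x_{n-1}$. A trace $\tilde{\mathbf{x}}$ of $\mathbf{x}$ is the random subsequence obtained by deleting each bit of $\mathbf{x}$ independently with probability $p$, where the deletion probability $p\in(0,1)$ is a constant, with the convention $\tilde x_j=0$ for $j>|\tilde{\mathbf{x}}|-1$. For $j=0,\dots,n-1$ let $E_j(\mathbf{x})=\mathbb{E}[\tilde x_j]$. Distinguishing $\mathbf{x}$ and $\mathbf{y}$: given the strings $\mathbf{x},\mathbf{y}$ and a set $S$ of independent traces of one of them, the algorithm must output, with probability at least $2/3$, which string is the source. An algorithm is mean-based if its output depends only on the statistical estimates of the means $E_j$,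 $j=0,\dots,n-1$, of the source; that is, it disregards the actual samples and uses only the empirical averages $\mathbb{E}_S[\tilde x_j]$ of each bit over the sample set $S$. The number of traces is $|S|$. The statement is asymptotic, as $k,n\to\infty$.
   Formalization: D(x) and D(y) have equal size and power sums, but may share elements; the disjoint PTE solution is D(x)∖D(y), D(y)∖D(x). Its size is between 1 and n, since size exactly n would force x = y = 1^n. The equation for n is read as ⌊(k ln² k)^{1/ε}⌋ ≤ n. *)

theory Defs
  imports "HOL-Probability.Probability"
begin

text \<open>Binary strings are \<^typ>\<open>bool list\<close>s, with \<^const>\<open>True\<close> for the bit 1.\<close>

definition ones :: "bool list \<Rightarrow> int set" where
  "ones x = {int i | i. i < length x \<and> x ! i}"


primrec trace_pmf :: "real \<Rightarrow> bool list \<Rightarrow> bool list pmf" where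
  "trace_pmf p [] = return_pmf []"
| "trace_pmf p (b # bs) =
     bind_pmf (bernoulli_pmf p) (\<lambda>deleted.
       map_pmf (\<lambda>t. if deleted then t else b # t) (trace_pmf p bs))"

definition trace_bit :: "bool list \<Rightarrow> nat \<Rightarrow> real" where
  "trace_bit t j = (if j < length t then of_bool (t ! j) else 0)"

definition empirical_mean :: "bool list list \<Rightarrow> nat \<Rightarrow> real" where
  "empirical_mean S j = (\<Sum>t\<leftarrow>S. trace_bit t j) / real (length S)"


text \<open>A distinguisher receives the two candidate strings and the list of sampled traces, and
  outputs the string it believes to be the source.\<close>

type_synonym distinguisher = "bool list \<Rightarrow> bool list \<Rightarrow> bool list list \<Rightarrow> bool list"

definition mean_based :: "distinguisher \<Rightarrow> bool" where
  "mean_based A \<longleftrightarrow>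
     (\<forall>x y S S'. length x = length y \<longrightarrow>
        (\<forall>j<length x. empirical_mean S j = empirical_mean S' j) \<longrightarrow> A x y S = A x y S')"

definition distinguishes ::
  "real \<Rightarrow> distinguisher \<Rightarrow> nat \<Rightarrow> bool list \<Rightarrow> bool list \<Rightarrow> bool" where
  "distinguishes p A m x y \<longleftrightarrow>
     measure_pmf.prob (replicate_pmf m (trace_pmf p x)) {S. A x y S = x} \<ge> 2 / 3 \<and>
     measure_pmf.prob (replicate_pmf m (trace_pmf p y)) {S. A x y S = y} \<ge> 2 / 3"

definition mean_based_requires :: "real \<Rightarrow> bool list \<Rightarrow> bool list \<Rightarrow> real \<Rightarrow> bool" where
  "mean_based_requires p x y T \<longleftrightarrow>
     (\<forall>A m. mean_based A \<longrightarrow> distinguishes p A m x y \<longrightarrow> T \<le> real m)"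


definition equal_power_sums :: "nat \<Rightarrow> int set \<Rightarrow> int set \<Rightarrow> bool" where
  "equal_power_sums k A B \<longleftrightarrow> (\<forall>j\<in>{1..k}. (\<Sum>a\<in>A. a ^ j) = (\<Sum>b\<in>B. b ^ j))"

definition pte_solution :: "nat \<Rightarrow> nat \<Rightarrow> int set \<Rightarrow> int set \<Rightarrow> bool" where
  "pte_solution k s A B \<longleftrightarrow>
     finite A \<and> finite B \<and> card A = s \<and> card B = s \<and> A \<inter> B = {} \<and> equal_power_sums k A B"

end

theory Submission
  imports Defs "HOL-Real_Asymp.Real_Asymp"
begin

text \<open>The idea is to test, for each \<open>r \<le> k\<close>, the binomial moment
  \<open>\<Sum>i. x\<^sub>i * (i choose r)\<close>. Deletion multiplies its expectation by \<open>(1 - p) ^ Suc r\<close>, so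
  the moment can be estimated from the averages of the individual bits. As the moments are
  integers, two strings with different \<open>r\<close>-th moments have expectations at distance at least
  \<open>(1 - p) ^ Suc r\<close>, and by Chebyshev's inequality \<open>12 * (n / (1 - p)) ^ (2 * Suc r)\<close> traces
  separate them. This number is \<open>exp (O(k * ln n)) = exp (o(n powr \<epsilon>))\<close>; hence the hypothesis
  makes all binomial moments of order at most \<open>k\<close> agree, and with them all power sums.\<close>

section \<open>Second moments and Chebyshev's inequality for independent samples\<close>

lemma expectation_bind_pmf_finite:
  fixes h :: "'b \<Rightarrow> real"
  assumes "finite (set_pmf P)" "\<And>u. u \<in> set_pmf P \<Longrightarrow> finite (set_pmf (f u))"
  shows "measure_pmf.expectation (bind_pmf P f) h =
         measure_pmf.expectation P (\<lambda>u. measure_pmf.expectation (f u) h)"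
  using assms by (subst pmf_expectation_bind[of "set_pmf P"])
    (auto simp: integral_measure_pmf[of "set_pmf P"])

lemma finite_set_replicate_pmf: "finite (set_pmf P) \<Longrightarrow> finite (set_pmf (replicate_pmf N P))"
  by (induction N) auto

lemma expectation_replicate_pmf_Suc:
  fixes h :: "'a list \<Rightarrow> real"
  assumes "finite (set_pmf P)"
  shows "measure_pmf.expectation (replicate_pmf (Suc N) P) h =
         measure_pmf.expectation P (\<lambda>u. measure_pmf.expectation (replicate_pmf N P) (\<lambda>S. h (u # S)))"
proof -
  have "replicate_pmf (Suc N) P = bind_pmf P (\<lambda>u. map_pmf ((#) u) (replicate_pmf N P))"
    by (simp add: map_pmf_def)
  then show ?thesis
    using assms by (simp add: expectation_bind_pmf_finite finite_set_replicate_pmf del: replicate_pmf.simps)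
qed

text \<open>Additivity of variance for independent centered variables: when the first sample is
  split off and the square expanded, the cross term vanishes because the remaining sum has mean
  zero.\<close>

lemma expectation_replicate_pmf_sum_square:
  fixes g :: "'a \<Rightarrow> real"
  assumes fin: "finite (set_pmf P)" and mean: "measure_pmf.expectation P g = 0"
  shows "measure_pmf.expectation (replicate_pmf N P) (\<lambda>S. (\<Sum>t\<leftarrow>S. g t)\<^sup>2) =
         real N * measure_pmf.expectation P (\<lambda>t. (g t)\<^sup>2)"
proof -
  note int = integrable_measure_pmf_finite[OF fin]
    integrable_measure_pmf_finite[OF finite_set_replicate_pmf[OF fin]]
  have zero: "measure_pmf.expectation (replicate_pmf N P) (\<lambda>S. \<Sum>t\<leftarrow>S. g t) = 0" for N
    by (induction N) (simp_all add: expectation_replicate_pmf_Suc[OF fin] int mean del: replicate_pmf.simps(2))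
  show "measure_pmf.expectation (replicate_pmf N P) (\<lambda>S. (\<Sum>t\<leftarrow>S. g t)\<^sup>2) =
         real N * measure_pmf.expectation P (\<lambda>t. (g t)\<^sup>2)"
  proof (induction N)
    case (Suc N)
    have "measure_pmf.expectation (replicate_pmf N P) (\<lambda>S. (g u + (\<Sum>t\<leftarrow>S. g t))\<^sup>2) =
        (g u)\<^sup>2 + real N * measure_pmf.expectation P (\<lambda>t. (g t)\<^sup>2)" for u
      by (simp add: power2_sum int zero Suc mult.assoc)
    then show ?case
      by (simp add: expectation_replicate_pmf_Suc[OF fin] int algebra_simps del: replicate_pmf.simps(2))
  qed simp
qed

text \<open>Chebyshev's inequality, obtained from Markov's inequality for the squared centered sum.
  The variance of one sample is at most its second moment, hence at most
  \<open>B\<^sup>2\<close>.\<close>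

lemma replicate_pmf_mean_deviation:
  fixes f :: "'a \<Rightarrow> real"
  assumes fin: "finite (set_pmf P)" and bound: "\<And>t. t \<in> set_pmf P \<Longrightarrow> \<bar>f t\<bar> \<le> B"
    and "N > 0" "\<delta> > 0"
  defines "\<mu> \<equiv> measure_pmf.expectation P f"
  shows "measure_pmf.prob (replicate_pmf N P) {S. \<bar>(\<Sum>t\<leftarrow>S. f t) / real N - \<mu>\<bar> \<ge> \<delta>} \<le>
         B\<^sup>2 / (real N * \<delta>\<^sup>2)"
proof -
  note int = integrable_measure_pmf_finite[OF fin]
    integrable_measure_pmf_finite[OF finite_set_replicate_pmf[OF fin]]
  define R where "R = replicate_pmf N P"
  define g where "g = (\<lambda>t. f t - \<mu>)"
  have "measure_pmf.expectation P g = 0"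
    by (simp add: g_def int \<mu>_def)
  note centered = expectation_replicate_pmf_sum_square[OF fin this, of N, folded R_def]
  have "measure_pmf.expectation P (\<lambda>t. (g t)\<^sup>2) =
      measure_pmf.expectation P (\<lambda>t. (f t)\<^sup>2) - \<mu>\<^sup>2"
    unfolding g_def \<mu>_def by (rule measure_pmf.variance_eq) (rule int)+
  also have "\<dots> \<le> measure_pmf.expectation P (\<lambda>t. (f t)\<^sup>2)"
    by simp
  also have "\<dots> \<le> measure_pmf.expectation P (\<lambda>t. B\<^sup>2)"
  proof (rule integral_mono_AE)
    show "AE t in P. (f t)\<^sup>2 \<le> B\<^sup>2"
      using power_mono[OF bound, of _ 2] by (auto simp: AE_measure_pmf_iff)
  qed (rule int)+
  finally have var: "measure_pmf.expectation P (\<lambda>t. (g t)\<^sup>2) \<le> B\<^sup>2"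
    by simp
  have "measure_pmf.prob R {S. \<bar>(\<Sum>t\<leftarrow>S. f t) / real N - \<mu>\<bar> \<ge> \<delta>} =
      measure_pmf.prob R {S. (\<Sum>t\<leftarrow>S. g t)\<^sup>2 \<ge> (real N * \<delta>)\<^sup>2}"
  \<comment> \<open>The two events are compared on the support only: there every list has length
    \<open>N\<close>, so the centered sum is \<open>N\<close> times the deviation of the
    average.\<close>
  proof (rule measure_pmf.finite_measure_eq_AE)
    have sum_g: "(\<Sum>t\<leftarrow>S. g t) = real N * ((\<Sum>t\<leftarrow>S. f t) / real N - \<mu>)" if "S \<in> set_pmf R" for S
      using that \<open>N > 0\<close>
      by (simp add: R_def set_replicate_pmf g_def sum_list_subtractf sum_list_triv right_diff_distrib)
    have "\<delta> \<le> \<bar>(\<Sum>t\<leftarrow>S. f t) / real N - \<mu>\<bar> \<longleftrightarrow> (real N * \<delta>)\<^sup>2 \<le> (\<Sum>t\<leftarrow>S. g t)\<^sup>2"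
      if "S \<in> set_pmf R" for S
      using \<open>N > 0\<close> \<open>\<delta> > 0\<close>
      unfolding sum_g[OF that] abs_le_square_iff[symmetric] by (simp add: abs_mult)
    then show "AE S in R. (S \<in> {S. \<bar>(\<Sum>t\<leftarrow>S. f t) / real N - \<mu>\<bar> \<ge> \<delta>}) =
        (S \<in> {S. (\<Sum>t\<leftarrow>S. g t)\<^sup>2 \<ge> (real N * \<delta>)\<^sup>2})"
      by (auto simp: AE_measure_pmf_iff)
  qed auto
  also have "\<dots> \<le> measure_pmf.expectation R (\<lambda>S. (\<Sum>t\<leftarrow>S. g t)\<^sup>2) / (real N * \<delta>)\<^sup>2"
    using integral_Markov_inequality_measure[of R "\<lambda>S. (\<Sum>t\<leftarrow>S. g t)\<^sup>2" UNIV "(real N * \<delta>)\<^sup>2"]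
      \<open>N > 0\<close> \<open>\<delta> > 0\<close> by (simp add: R_def int)
  also have "\<dots> \<le> real N * B\<^sup>2 / (real N * \<delta>)\<^sup>2"
    unfolding centered by (intro divide_right_mono mult_left_mono var) auto
  also have "\<dots> = B\<^sup>2 / (real N * \<delta>\<^sup>2)"
    using \<open>N > 0\<close> by (simp add: power2_eq_square)
  finally show ?thesis
    by (simp add: R_def)
qed

section \<open>Binomial moments of a string and of its traces\<close>

definition choose_sum :: "nat \<Rightarrow> bool list \<Rightarrow> real" where
  "choose_sum r t = (\<Sum>j<length t. real (j choose r) * of_bool (t ! j))"

lemma choose_sum_Nil [simp]: "choose_sum r [] = 0"
  by (simp add: choose_sum_def)

lemma choose_sum_0_Cons: "choose_sum 0 (b # t) = of_bool b + choose_sum 0 t"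
  by (simp add: choose_sum_def sum.lessThan_Suc_shift del: sum.lessThan_Suc)

text \<open>Pascal's rule at each shifted position. The new bit sits at position 0, where
  \<open>0 choose Suc r\<close> vanishes, so \<open>b\<close> drops out.\<close>

lemma choose_sum_Suc_Cons: "choose_sum (Suc r) (b # t) = choose_sum r t + choose_sum (Suc r) t"
  by (simp add: choose_sum_def sum.lessThan_Suc_shift sum.distrib ring_distribs del: sum.lessThan_Suc)

lemma choose_sum_bound:
  assumes "length t \<le> n"
  shows "\<bar>choose_sum r t\<bar> \<le> real n ^ Suc r"
proof -
  have le: "real (j choose r) * of_bool (t ! j) \<le> real n ^ r" if "j < length t" for j
  proof -
    have "j choose r \<le> j ^ r"
      by (cases "r \<le> j") (auto intro: binomial_le_pow simp: binomial_eq_0)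
    also have "\<dots> \<le> n ^ r"
      using that assms by (intro power_mono) auto
    finally show ?thesis
      by (simp flip: of_nat_power)
  qed
  have "choose_sum r t \<le> (\<Sum>j<length t. real n ^ r)"
    unfolding choose_sum_def by (intro sum_mono) (use le in auto)
  also have "\<dots> \<le> real n * real n ^ r"
    using assms by (simp add: mult_right_mono)
  finally show ?thesis
    by (simp add: choose_sum_def sum_nonneg)
qed

lemma finite_set_trace_pmf: "finite (set_pmf (trace_pmf p x))"
  by (induction x) auto

lemma length_trace: "t \<in> set_pmf (trace_pmf p x) \<Longrightarrow> length t \<le> length x"
  by (induction x arbitrary: t) (auto split: if_splits, fastforce+)

lemma expectation_trace_Cons:
  fixes h :: "bool list \<Rightarrow> real"
  assumes "0 \<le> p" "p \<le> 1"
  shows "measure_pmf.expectation (trace_pmf p (b # x)) h =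
    p * measure_pmf.expectation (trace_pmf p x) h +
    (1 - p) * measure_pmf.expectation (trace_pmf p x) (\<lambda>t. h (b # t))"
  using assms by (simp add: expectation_bind_pmf_finite finite_set_trace_pmf)

text \<open>A one at position \<open>i\<close> that survives moves to a binomially distributed position, whose
  \<open>r\<close>-th factorial moment is that of \<open>i\<close> times \<open>(1 - p) ^ r\<close>.\<close>

lemma expectation_choose_sum_trace:
  assumes "0 \<le> p" "p \<le> 1"
  shows "measure_pmf.expectation (trace_pmf p x) (choose_sum r) = (1 - p) ^ Suc r * choose_sum r x"
proof (induction x arbitrary: r)
  case (Cons b x)
  note int = integrable_measure_pmf_finite[OF finite_set_trace_pmf]
  show ?case
  proof (cases r)
    case 0
    then show ?thesis
      by (simp add: expectation_trace_Cons[OF assms] choose_sum_0_Cons int Cons algebra_simps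
          del: trace_pmf.simps)
  next
    case (Suc s)
    then show ?thesis
      by (simp add: expectation_trace_Cons[OF assms] choose_sum_Suc_Cons int Cons algebra_simps
          del: trace_pmf.simps)
  qed
qed simp

section \<open>Estimating binomial moments from bit averages\<close>

definition choose_mean :: "nat \<Rightarrow> nat \<Rightarrow> bool list list \<Rightarrow> real" where
  "choose_mean r n S = (\<Sum>j<n. real (j choose r) * empirical_mean S j)"

text \<open>Exchanging the sums turns the statistic computed from bit averages into an average over
  samples, to which Chebyshev's inequality applies. Cutting off at \<open>n\<close> loses nothing,
  since \<open>trace_bit\<close> is 0 beyond the end of a trace.\<close>

lemma choose_mean_eq:
  assumes "\<And>t. t \<in> set S \<Longrightarrow> length t \<le> n"
  shows "choose_mean r n S = (\<Sum>t\<leftarrow>S. choose_sum r t) / real (length S)"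
proof -
  have "choose_sum r t = (\<Sum>j<n. real (j choose r) * trace_bit t j)" if "t \<in> set S" for t
    unfolding choose_sum_def trace_bit_def
    by (rule sum.mono_neutral_cong_left) (use assms[OF that] in auto)
  then have "(\<Sum>t\<leftarrow>S. choose_sum r t) = (\<Sum>t\<leftarrow>S. \<Sum>j<n. real (j choose r) * trace_bit t j)"
    by (intro arg_cong[of _ _ sum_list] map_cong) auto
  also have "\<dots> = (\<Sum>j<n. real (j choose r) * (\<Sum>t\<leftarrow>S. trace_bit t j))"
    by (induction S) (simp_all add: sum.distrib ring_distribs)
  finally show ?thesis
    by (simp add: choose_mean_def empirical_mean_def sum_divide_distrib)
qed

text \<open>Chebyshev's inequality with bound \<open>n ^ Suc r\<close> and tolerance
  \<open>(1 - p) ^ Suc r / 2\<close> gives failure probability at most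
  \<open>4 * (n / (1 - p)) ^ (2 * Suc r) / N\<close>. The factor 12 brings this down to 1/3.\<close>

lemma choose_mean_deviation:
  assumes p: "0 \<le> p" "p < 1" and len: "length x = n" and "n > 0"
    and N: "12 * (real n / (1 - p)) ^ (2 * Suc r) \<le> real N"
  shows "measure_pmf.prob (replicate_pmf N (trace_pmf p x))
    {S. \<bar>choose_mean r n S - (1 - p) ^ Suc r * choose_sum r x\<bar> < (1 - p) ^ Suc r / 2} \<ge> 2 / 3"
    (is "measure_pmf.prob ?R ?good \<ge> _")
proof -
  define q where "q = (1 - p) ^ Suc r"
  have q: "q > 0"
    using p by (simp add: q_def)
  have pos: "0 < 12 * (real n / (1 - p)) ^ (2 * Suc r)"
    using p \<open>n > 0\<close> by simp
  with N have "N > 0"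
    by (cases N) auto
  let ?bad = "{S. \<bar>(\<Sum>t\<leftarrow>S. choose_sum r t) / real N - q * choose_sum r x\<bar> \<ge> q / 2}"
  have "measure_pmf.prob ?R ?bad \<le> (real n ^ Suc r)\<^sup>2 / (real N * (q / 2)\<^sup>2)"
  proof -
    have "\<bar>choose_sum r t\<bar> \<le> real n ^ Suc r" if "t \<in> set_pmf (trace_pmf p x)" for t
      using length_trace[OF that] len by (intro choose_sum_bound) simp
    with replicate_pmf_mean_deviation[OF finite_set_trace_pmf, of p x "choose_sum r" _ N "q / 2"]
    show ?thesis
      using q p \<open>N > 0\<close> by (simp add: expectation_choose_sum_trace q_def[symmetric] del: power_Suc)
  qed
  also have "\<dots> = 4 * (real n / (1 - p)) ^ (2 * Suc r) / real N"
    unfolding q_def by (simp add: power_divide power_mult[symmetric] mult.commute del: power_Suc)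
  also have "\<dots> \<le> 1 / 3"
    using N \<open>N > 0\<close> by (subst pos_divide_le_eq) (simp, linarith)
  finally have bad: "measure_pmf.prob ?R ?bad \<le> 1 / 3" .
  have mean: "choose_mean r n S = (\<Sum>t\<leftarrow>S. choose_sum r t) / real N" if "S \<in> set_pmf ?R" for S
  proof -
    have "length S = N" "\<And>t. t \<in> set S \<Longrightarrow> length t \<le> n"
      using that len by (auto simp: set_replicate_pmf dest: length_trace)
    then show ?thesis
      using choose_mean_eq[of S n r] by simp
  qed
  have "measure_pmf.prob ?R ?good = measure_pmf.prob ?R (- ?bad)"
    by (rule measure_pmf.finite_measure_eq_AE)
      (auto simp: AE_measure_pmf_iff mean q_def)
  also have "\<dots> = 1 - measure_pmf.prob ?R ?bad"
    using measure_pmf.prob_compl[of ?bad ?R] by (simp add: Compl_eq_Diff_UNIV)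
  finally show ?thesis
    using bad by simp
qed

lemma choose_sum_ones: "choose_sum r x = real (\<Sum>i\<in>{i. i < length x \<and> x ! i}. i choose r)"
proof -
  have "choose_sum r x = (\<Sum>i\<in>{i. i < length x \<and> x ! i}. real (i choose r))"
    unfolding choose_sum_def by (rule sum.mono_neutral_cong_right) auto
  then show ?thesis
    by simp
qed

text \<open>The nearest-mean test works: the two expectations are at least
  \<open>q = (1 - p) ^ Suc r\<close> apart, and with probability at least 2/3 the estimate lies
  within \<open>q / 2\<close> of the true one.\<close>

lemma choose_sum_distinguishes:
  assumes p: "0 \<le> p" "p < 1" and len: "length x = n" "length y = n"
    and ne: "choose_sum r x \<noteq> choose_sum r y"
    and N: "12 * (real n / (1 - p)) ^ (2 * Suc r) \<le> real N"
  shows "\<exists>A. mean_based A \<and> distinguishes p A N x y"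
proof -
  define q where "q = (1 - p) ^ Suc r"
  have q: "q > 0"
    using p by (simp add: q_def)
  have "n > 0"
    using ne len by (cases n) auto
  \<comment> \<open>The deletion probability is built into the test through \<open>q\<close>, and
    the samples enter only through \<open>choose_mean\<close>. Ties go to \<open>v\<close>; they
    cannot occur for \<open>x\<close> and \<open>y\<close> when the estimate is within
    \<open>q / 2\<close> of either expectation.\<close>
  define A :: distinguisher where "A = (\<lambda>u v S.
    if \<bar>choose_mean r (length u) S - q * choose_sum r u\<bar> <
       \<bar>choose_mean r (length u) S - q * choose_sum r v\<bar> then u else v)"
  have "choose_mean r (length u) S = choose_mean r (length u) S'"
    if "\<forall>j<length u. empirical_mean S j = empirical_mean S' j" for u :: "bool list" and S S'
    using that by (simp add: choose_mean_def)
  then have "mean_based A"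
    unfolding mean_based_def A_def by metis
  moreover have "distinguishes p A N x y"
  proof -
    \<comment> \<open>Distinct integers differ by at least 1.\<close>
    have "\<bar>choose_sum r x - choose_sum r y\<bar> \<ge> 1"
    proof -
      have "1 \<le> \<bar>real a - real b\<bar>" if "a \<noteq> b" for a b :: nat
        using that by linarith
      then show ?thesis
        using ne unfolding choose_sum_ones by (metis of_nat_eq_iff)
    qed
    then have "q * \<bar>choose_sum r x - choose_sum r y\<bar> \<ge> q"
      using q by simp
    then have sep: "\<bar>q * choose_sum r x - q * choose_sum r y\<bar> \<ge> q"
      using q by (simp add: abs_mult flip: right_diff_distrib)
    have near: "2 / 3 \<le> measure_pmf.prob (replicate_pmf N (trace_pmf p z)) Z"
      if "length z = n" "\<And>S. \<bar>choose_mean r n S - q * choose_sum r z\<bar> < q / 2 \<Longrightarrow> S \<in> Z" for z Z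
    proof -
      have "2 / 3 \<le> measure_pmf.prob (replicate_pmf N (trace_pmf p z))
          {S. \<bar>choose_mean r n S - q * choose_sum r z\<bar> < q / 2}"
        unfolding q_def by (rule choose_mean_deviation) (use p that \<open>n > 0\<close> N in auto)
      also have "\<dots> \<le> measure_pmf.prob (replicate_pmf N (trace_pmf p z)) Z"
        using that(2) by (intro measure_pmf.finite_measure_mono) auto
      finally show ?thesis .
    qed
    show ?thesis
      unfolding distinguishes_def
    proof (intro conjI near)
      fix S
      assume "\<bar>choose_mean r n S - q * choose_sum r x\<bar> < q / 2"
      with sep have "\<bar>choose_mean r n S - q * choose_sum r x\<bar> <
          \<bar>choose_mean r n S - q * choose_sum r y\<bar>"
        by linarith
      then show "S \<in> {S. A x y S = x}"
        by (simp add: A_def len)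
    next
      fix S
      assume "\<bar>choose_mean r n S - q * choose_sum r y\<bar> < q / 2"
      with sep have "\<not> \<bar>choose_mean r n S - q * choose_sum r x\<bar> <
          \<bar>choose_mean r n S - q * choose_sum r y\<bar>"
        by linarith
      then show "S \<in> {S. A x y S = y}"
        by (simp add: A_def len)
    qed (use len in auto)
  qed
  ultimately show ?thesis
    by blast
qed

section \<open>From binomial moments to power sums\<close>

text \<open>Mixed moments \<open>i ^ j * (i choose r)\<close> with \<open>j + r \<le> k\<close>
  allow an induction on \<open>j\<close> that avoids Stirling numbers; \<open>r = 0\<close> gives
  the claim.\<close>

lemma binomial_moments_power_moments:
  fixes A B :: "nat set"
  assumes "\<And>r. r \<le> k \<Longrightarrow> (\<Sum>i\<in>A. i choose r) = (\<Sum>i\<in>B. i choose r)" and "j \<le> k"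
  shows "(\<Sum>i\<in>A. i ^ j) = (\<Sum>i\<in>B. i ^ j)"
proof -
  have "(\<Sum>i\<in>A. i ^ j * (i choose r)) = (\<Sum>i\<in>B. i ^ j * (i choose r))" if "j + r \<le> k" for r
    using that
  proof (induction j arbitrary: r)
    case 0
    then show ?case
      using assms(1) by simp
  next
    case (Suc j)
    \<comment> \<open>Absorbing one factor \<open>i\<close> raises the order of the binomial
      coefficient by at most one, so trading a power for an order keeps \<open>j + r\<close> within
      \<open>k\<close>.\<close>
    have "i * (i choose r) = Suc r * (i choose Suc r) + r * (i choose r)" for i
      using Suc_times_binomial[of r i] by (simp add: algebra_simps)
    then have "i ^ Suc j * (i choose r) =
        Suc r * (i ^ j * (i choose Suc r)) + r * (i ^ j * (i choose r))" for i
      by (metis (no_types, lifting) power_Suc2 mult.assoc mult.left_commute distrib_left)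
    then show ?case
      using Suc.IH[of r] Suc.IH[of "Suc r"] Suc.prems
      by (simp add: sum.distrib del: power_Suc mult_Suc flip: sum_distrib_left)
  qed
  from this[of 0] show ?thesis
    using \<open>j \<le> k\<close> by simp
qed

lemma ones_eq_image: "ones x = int ` {i. i < length x \<and> x ! i}"
  by (auto simp: ones_def)

lemma finite_ones: "finite (ones x)"
  by (simp add: ones_eq_image)

lemma ones_inj: "length x = length y \<Longrightarrow> ones x = ones y \<Longrightarrow> x = y"
  by (rule nth_equalityI) (auto simp: ones_eq_image inj_image_eq_iff)

text \<open>Equality of cardinalities is the power sum of exponent 0, which
  \<open>equal_power_sums\<close> leaves out.\<close>

lemma ones_power_sums_eq:
  assumes "\<And>r. r \<le> k \<Longrightarrow> choose_sum r x = choose_sum r y"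
  shows "card (ones x) = card (ones y)" "equal_power_sums k (ones x) (ones y)"
proof -
  have *: "(\<Sum>a\<in>ones x. a ^ j) = (\<Sum>b\<in>ones y. b ^ j)" if "j \<le> k" for j
  proof -
    have "(\<Sum>i | i < length x \<and> x ! i. i ^ j) = (\<Sum>i | i < length y \<and> y ! i. i ^ j)"
      by (rule binomial_moments_power_moments[OF _ that])
        (use assms in \<open>simp add: choose_sum_ones del: of_nat_sum\<close>)
    then have "int (\<Sum>i | i < length x \<and> x ! i. i ^ j) = int (\<Sum>i | i < length y \<and> y ! i. i ^ j)"
      by simp
    then show ?thesis
      by (simp add: ones_eq_image sum.reindex)
  qed
  from *[of 0] show "card (ones x) = card (ones y)"
    by simp
  show "equal_power_sums k (ones x) (ones y)"
    using * by (auto simp: equal_power_sums_def)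
qed

lemma pte_solution_Diff:
  assumes "finite A" "finite B" "card A = card B" "equal_power_sums k A B"
  shows "pte_solution k (card (A - B)) (A - B) (B - A)"
proof -
  have "card (A - B) = card (B - A)"
    using card_Diff_subset_Int[of A B] card_Diff_subset_Int[of B A] assms
    by (simp add: Int_commute)
  moreover have "(\<Sum>a\<in>A. a ^ j) = (\<Sum>a\<in>A - B. a ^ j) + (\<Sum>a\<in>A \<inter> B. a ^ j)"
    "(\<Sum>a\<in>B. a ^ j) = (\<Sum>a\<in>B - A. a ^ j) + (\<Sum>a\<in>A \<inter> B. a ^ j)" for j
    using assms sum.Int_Diff[of A "\<lambda>a. a ^ j" B] sum.Int_Diff[of B "\<lambda>a. a ^ j" A]
    by (simp_all add: Int_commute)
  ultimately show ?thesis
    using assms by (auto simp: pte_solution_def equal_power_sums_def)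
qed

section \<open>Asymptotics of the degree and of the number of traces\<close>

text \<open>If \<open>k\<close> exceeds \<open>n powr (\<epsilon> / 2)\<close>, then
  \<open>ln k\<close> is at least \<open>\<epsilon> / 2 * ln n\<close>, and the size relation bounds
  \<open>k\<close> by the second summand. Adding the two bounds covers both cases.\<close>

lemma degree_bound:
  assumes "0 < \<epsilon>" "\<epsilon> \<le> 1" and "2 \<le> n"
    and k: "\<lfloor>(real k * (ln (real k))\<^sup>2) powr (1 / \<epsilon>)\<rfloor> \<le> int n"
  shows "real k \<le> real n powr (\<epsilon> / 2) + 8 * real n powr \<epsilon> / (\<epsilon> * ln (real n))\<^sup>2"
proof (cases "real k \<le> real n powr (\<epsilon> / 2)")
  case True
  then show ?thesis
    by (simp add: add_increasing2)
next
  case False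
  define M where "M = real k * (ln (real k))\<^sup>2"
  have "1 \<le> real n powr (\<epsilon> / 2)"
    using assms by (simp add: ge_one_powr_ge_zero)
  with False have "1 < real k"
    by linarith
  have ln_n: "0 < ln (real n)"
    using \<open>2 \<le> n\<close> by simp
  have "\<epsilon> / 2 * ln (real n) = ln (real n powr (\<epsilon> / 2))"
    by (simp add: ln_powr)
  also have "\<dots> \<le> ln (real k)"
    using False \<open>2 \<le> n\<close> \<open>1 < real k\<close> by (intro ln_mono) auto
  finally have "real k * (\<epsilon> / 2 * ln (real n))\<^sup>2 \<le> M"
    unfolding M_def using ln_n assms by (intro mult_left_mono power_mono) auto
  also have "M \<le> (2 * real n) powr \<epsilon>"
  proof -
    have "M \<ge> 0"
      by (simp add: M_def)
    \<comment> \<open>Undoing the floor costs less than 1, and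
      \<open>n + 1 \<le> 2 * n\<close>.\<close>
    have "M powr (1 / \<epsilon>) \<le> 2 * real n"
      using k \<open>2 \<le> n\<close> unfolding M_def by linarith
    then have "(M powr (1 / \<epsilon>)) powr \<epsilon> \<le> (2 * real n) powr \<epsilon>"
      using \<open>0 < \<epsilon>\<close> by (intro powr_mono2) auto
    then show ?thesis
      using \<open>0 < \<epsilon>\<close> \<open>M \<ge> 0\<close> by (simp add: powr_powr)
  qed
  also have "\<dots> \<le> 2 * real n powr \<epsilon>"
    using assms powr_mono[of \<epsilon> 1 2] by (simp add: powr_mult)
  finally have "real k * (\<epsilon> * ln (real n))\<^sup>2 \<le> 8 * real n powr \<epsilon>"
    by (simp add: power2_eq_square)
  moreover have "0 < (\<epsilon> * ln (real n))\<^sup>2"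
    using ln_n assms by simp
  ultimately have "real k \<le> 8 * real n powr \<epsilon> / (\<epsilon> * ln (real n))\<^sup>2"
    by (simp add: pos_le_divide_eq)
  then show ?thesis
    by (simp add: add_increasing)
qed

text \<open>The left side bounds the logarithm of the number of traces used by the test, with
  \<open>k\<close> replaced by its bound from \<open>degree_bound\<close>. Its dominant term has
  order \<open>n powr \<epsilon> / ln n\<close>: the squared logarithm in the size relation
  outweighs the factor \<open>ln n\<close>.\<close>

lemma trace_budget:
  fixes \<epsilon> c p :: real
  assumes "0 < p" "p < 1" "0 < \<epsilon>" "0 < c"
  shows "\<forall>\<^sub>F n in sequentially.
    2 * (real n powr (\<epsilon> / 2) + 8 * real n powr \<epsilon> / (\<epsilon> * ln (real n))\<^sup>2 + 1) *
      (ln (real n) - ln (1 - p)) + ln 13 < c * real n powr \<epsilon>"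
proof -
  have "(\<lambda>n. (2 * (real n powr (\<epsilon> / 2) + 8 * real n powr \<epsilon> / (\<epsilon> * ln (real n))\<^sup>2 + 1) *
      (ln (real n) - ln (1 - p)) + ln 13) / real n powr \<epsilon>) \<longlonglongrightarrow> 0"
    using assms by real_asymp
  then have "\<forall>\<^sub>F n in sequentially.
      (2 * (real n powr (\<epsilon> / 2) + 8 * real n powr \<epsilon> / (\<epsilon> * ln (real n))\<^sup>2 + 1) *
      (ln (real n) - ln (1 - p)) + ln 13) / real n powr \<epsilon> < c"
    by (rule order_tendstoD) (use assms in simp)
  then show ?thesis
    using eventually_gt_at_top[of 0] by eventually_elim (simp add: pos_divide_less_eq)
qed

(* The constant c is the one hidden in exp(Omega(n^eps)).  The relation n = (k log^2 k)^(1/eps)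
   can only hold up to rounding; the floor condition covers n equal to either rounding of the
   right-hand side.  Positions where both strings have a 1 contribute equally to all power sums
   and are cancelled to meet the disjointness requirement on a PTE solution. *)
theorem theorem3:
  fixes p \<epsilon> c :: real
  assumes "0 < p" "p < 1" and "0 < \<epsilon>" "\<epsilon> \<le> 1 / 3" and "0 < c"
  shows "\<forall>\<^sub>F n in sequentially. \<forall>(k::nat) (x::bool list) (y::bool list).
           length x = n \<longrightarrow> length y = n \<longrightarrow> x \<noteq> y \<longrightarrow>
           \<lfloor>(real k * (ln (real k))\<^sup>2) powr (1 / \<epsilon>)\<rfloor> \<le> int n \<longrightarrow>
           mean_based_requires p x y (exp (c * real n powr \<epsilon>)) \<longrightarrow>
             card (ones x) = card (ones y) \<and> equal_power_sums k (ones x) (ones y) \<and>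
             (\<exists>s\<in>{1..n}. pte_solution k s (ones x - ones y) (ones y - ones x))"
  using trace_budget[OF assms(1,2,3,5)] eventually_ge_at_top[of 2]
proof eventually_elim
  case (elim n)
  show ?case
  proof (intro allI impI)
    fix k :: nat and x y :: "bool list"
    assume len: "length x = n" "length y = n" and "x \<noteq> y"
      and k: "\<lfloor>(real k * (ln (real k))\<^sup>2) powr (1 / \<epsilon>)\<rfloor> \<le> int n"
      and req: "mean_based_requires p x y (exp (c * real n powr \<epsilon>))"
    have "choose_sum r x = choose_sum r y" if "r \<le> k" for r
    proof (rule ccontr)
      assume ne: "choose_sum r x \<noteq> choose_sum r y"
      define z where "z = real n / (1 - p)"
      \<comment> \<open>The least number of traces for which the test is guaranteed to work.
        Rounding up adds at most 1, which turns the constant 12 into 13 because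
        \<open>z \<ge> 1\<close>.\<close>
      define N where "N = nat \<lceil>12 * z ^ (2 * Suc r)\<rceil>"
      have z: "1 \<le> z" "ln z = ln (real n) - ln (1 - p)"
        using assms elim(2) by (auto simp: z_def ln_div)
      have "12 * z ^ (2 * Suc r) \<le> real N"
        unfolding N_def by linarith
      then obtain A where "mean_based A" "distinguishes p A N x y"
        using choose_sum_distinguishes[OF _ _ len ne, of p N] assms unfolding z_def by auto
      with req have "exp (c * real n powr \<epsilon>) \<le> real N"
        unfolding mean_based_requires_def by blast
      also have "real N \<le> 12 * z ^ (2 * Suc r) + 1"
        unfolding N_def using z(1) zero_le_power[of z "2 * Suc r"] by linarith
      also have "\<dots> \<le> 13 * z ^ (2 * Suc r)"
        using one_le_power[OF z(1), of "2 * Suc r"] by linarith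
      also have "\<dots> \<le> 13 * z ^ (2 * Suc k)"
        using that z(1) by (intro mult_left_mono power_increasing) auto
      also have "\<dots> = exp (2 * (real k + 1) * ln z + ln 13)"
      proof -
        have "z ^ (2 * Suc k) = exp (real (2 * Suc k) * ln z)"
          using z(1) by (simp only: exp_of_nat_mult) simp
        then show ?thesis
          by (simp add: exp_add algebra_simps)
      qed
      also have "\<dots> \<le> exp (2 * (real n powr (\<epsilon> / 2) +
          8 * real n powr \<epsilon> / (\<epsilon> * ln (real n))\<^sup>2 + 1) * ln z + ln 13)"
        using degree_bound[OF _ _ elim(2) k] assms z(1)
        by (intro exp_le_cancel_iff[THEN iffD2] add_right_mono mult_right_mono mult_left_mono) auto
      also have "\<dots> < exp (c * real n powr \<epsilon>)"
        using elim(1) by (simp add: z(2))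
      finally show False
        by simp
    qed
    note power_sums = ones_power_sums_eq[OF this]
    have pte: "pte_solution k (card (ones x - ones y)) (ones x - ones y) (ones y - ones x)"
      by (intro pte_solution_Diff finite_ones power_sums)
    \<comment> \<open>Otherwise \<open>ones x\<close> would be a subset of \<open>ones y\<close> of
      the same cardinality, so the sets and hence the strings would coincide.\<close>
    have "ones x - ones y \<noteq> {}"
      using \<open>x \<noteq> y\<close> len power_sums(1) ones_inj[of x y] card_subset_eq[OF finite_ones, of "ones x" y]
      by auto
    then have "1 \<le> card (ones x - ones y)"
      using finite_ones by (simp add: Suc_le_eq card_gt_0_iff)
    moreover have "card (ones x - ones y) \<le> n"
    proof -
      have "card (ones x - ones y) \<le> card (int ` {..<n})"
        using len by (intro card_mono) (auto simp: ones_def)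
      then show ?thesis
        by (simp add: card_image)
    qed
    ultimately show "card (ones x) = card (ones y) \<and> equal_power_sums k (ones x) (ones y) \<and>
        (\<exists>s\<in>{1..n}. pte_solution k s (ones x - ones y) (ones y - ones x))"
      using power_sums pte by auto
  qed
qed

end
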